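(* Suppose the system $\mathcal S$ (defined in the context) is mean-square exponential incrementally stable. Then the system $$x_{n+1}=f(x_n)+\xi_n B k(x_n)+\gamma_n$$ is second moment bounded, i.e., for its trajectories starting from $x_0\in\mathbb R^N$, $$E_{\xi_0^n\gamma_0^n}\left[\|x_{n+1}\|^2\right]\le \chi(x_0)<\infty \qquad \forall n\ge 0,$$ where $\chi$ is a function of the initial condition $x_0$, the distribution of $\xi$, and the constant $C$ bounding the second moment of $\gamma_n$ (in particular $\chi(x_0)$ does not depend on $n$).
   Context: Notation: $'$ denotes transpose; $\|\cdot\|$ is the Euclidean norm; matrix inequalities are in the sense of symmetric matrices; products $\prod_{j=\ell}^n M_j$ mean $M_n\cdots M_\ell$; $\xi_0^n=(\xi_0,\dots,\xi_n)$, $\gamma_0^n=(\gamma_0,\dots,\gamma_n)$. Setting: $f:\mathbb R^N\to\mathbb R^N$, $B\in\mathbb R^{N\times d}$, $k:\mathbb R^N\to\mathbb R^d$. $\xi_n\in\mathbb R$ is an IID sequence with $E[\xi_n]=\mu$, $E[(\xi_n-\mu)^2]=\sigma^2\ne 0$. $\gamma_n\in\mathbb R^N$ is an IID sequence with $E[\gamma_n]=0$, $E[\|\gamma_n\|^2]\le C$ for a constant $C$. $w_n\in\mathbb R^d$ is an exogenous deterministic input sequence. Standing assumptions: (1) $f$ is at least $C^1$; $\frac{\partial f}{\partial x}(x)$ is invertible and uniformly bounded for Lebesgue almost all $x\in\mathbb R^N$ and for $x=0$; $x=0$ is an equilibrium ($f(0)=0$) and all eigenvalues $\lambda_0^i$,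 $i=1,\dots,N$, of $\frac{\partial f}{\partial x}(0)$ satisfy $|\lambda_0^i|>1$; $B'B>0$. (2) There exist $k_1,k_2>0$ and an integer $m\ge0$ such that $k_1I\le\sum_{\ell=0}^{m}\Phi(x_m,x_\ell)BB'\Phi'(x_m,x_\ell)\le k_2I$ for Lebesgue almost all $x_0\in\mathbb R^N$ and for $x_0=0$, where $x_{n+1}=f(x_n)$ and $\Phi(x_n,x_\ell)=\prod_{j=\ell}^n\frac{\partial f}{\partial x}(x_j)$. (3) The controller $k$ is memoryless, deterministic, at least $C^1$, has uniformly bounded Jacobian, $k(0)=0$, and for some $\alpha>0$, $\left(\frac{\partial f}{\partial x}+\mu B\frac{\partial k}{\partial x}\right)'\left(\frac{\partial f}{\partial x}+\mu B\frac{\partial k}{\partial x}\right)\ge\alpha I$ for almost all $x\in\mathbb R^N$. The system $\mathcal S$ is the pair of systems $$x_{n+1}=f(x_n)+\xi_nBk(x_n)+\xi_nBw_n+\gamma_n,\qquad x_{n+1}=f(x_n)+\xi_nBk(x_n)+\xi_nBw_n .$$ $\mathcal S$ is mean-square exponential incrementally stable if there exist positive constants $K<\infty$ and $\beta<1$ such that, for Lebesgue almost all $x_0,y_0\in\mathbb R^N$ and in particular for $x_0=0$, for any $w_n$ (including $w_n\equiv0$), and both with and without the additive noise term $\gamma_n$, $$E_{\mathcal X_0^n}\left[\|x_{n+1}-y_{n+1}\|^2\right]\le K\beta^n\|x_0-y_0\|^2\quad\forall n\ge0,$$ where $\{x_n\},\{y_n\}$ are trajectories starting from $x_0,y_0$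 and subject to the same sequences $w_n$, $\xi_n$, $\gamma_n$, and $\mathcal X_0^n$ is $\{\xi_0^n,\gamma_0^n\}$ with noise and $\{\xi_0^n\}$ without noise. *)

theory Defs
  imports "HOL-Probability.Probability"
begin

definition psd_matrix :: "real^'n^'n \<Rightarrow> bool" where
  "psd_matrix A \<longleftrightarrow> transpose A = A \<and> (\<forall>v. 0 \<le> v \<bullet> (A *v v))"

definition pd_matrix :: "real^'n^'n \<Rightarrow> bool" where
  "pd_matrix A \<longleftrightarrow> transpose A = A \<and> (\<forall>v. v \<noteq> 0 \<longrightarrow> 0 < v \<bullet> (A *v v))"

definition loewner_le :: "real^'n^'n \<Rightarrow> real^'n^'n \<Rightarrow> bool" where
  "loewner_le A B \<longleftrightarrow> psd_matrix (B - A)"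

definition complex_eigenvalue :: "real^'n^'n \<Rightarrow> complex \<Rightarrow> bool" where
  "complex_eigenvalue A z \<longleftrightarrow>
     (\<exists>v :: complex^'n. v \<noteq> 0 \<and> map_matrix complex_of_real A *v v = z *s v)"

definition C1_map :: "(real^'n \<Rightarrow> real^'m) \<Rightarrow> bool" where
  "C1_map g \<longleftrightarrow> (\<forall>x. g differentiable (at x)) \<and> continuous_on UNIV (\<lambda>x. jacobian g (at x))"

definition plant_assumptions :: "(real^'n \<Rightarrow> real^'n) \<Rightarrow> real^'d^'n \<Rightarrow> bool" where
  "plant_assumptions f B \<longleftrightarrow>
     C1_map f \<and>
     (\<exists>L. (AE x in lebesgue. invertible (jacobian f (at x)) \<and> norm (jacobian f (at x)) \<le> L) \<and>
          invertible (jacobian f (at 0)) \<and> norm (jacobian f (at 0)) \<le> L) \<and>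
     f 0 = 0 \<and>
     (\<forall>z. complex_eigenvalue (jacobian f (at 0)) z \<longrightarrow> cmod z > 1) \<and>
     pd_matrix (transpose B ** B)"

text \<open>
  The product of the Jacobians along the orbit \<open>x\<^sub>j = (f ^^ j) x\<^sub>0\<close> for \<open>j = l, \<dots>, n\<close>, both ends
  included, with later factors on the left.
\<close>

definition transition_matrix ::
    "(real^'n \<Rightarrow> real^'n) \<Rightarrow> real^'n \<Rightarrow> nat \<Rightarrow> nat \<Rightarrow> real^'n^'n" where
  "transition_matrix f x0 n l =
     fold (\<lambda>j A. jacobian f (at ((f ^^ j) x0)) ** A) [l..<Suc n] (mat 1)"

definition gramian ::
    "(real^'n \<Rightarrow> real^'n) \<Rightarrow> real^'d^'n \<Rightarrow> nat \<Rightarrow> real^'n \<Rightarrow> real^'n^'n" where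
  "gramian f B m x0 =
     (\<Sum>l=0..m. transition_matrix f x0 m l ** B ** transpose B ** transpose (transition_matrix f x0 m l))"

text \<open>Here \<open>mat c\<close> is the library's \<open>c\<close> times the identity matrix.\<close>

definition gramian_bounds :: "(real^'n \<Rightarrow> real^'n) \<Rightarrow> real^'d^'n \<Rightarrow> bool" where
  "gramian_bounds f B \<longleftrightarrow>
     (\<exists>k1 k2 m. 0 < k1 \<and> 0 < k2 \<and>
        (AE x0 in lebesgue. loewner_le (mat k1) (gramian f B m x0) \<and>
                            loewner_le (gramian f B m x0) (mat k2)) \<and>
        loewner_le (mat k1) (gramian f B m 0) \<and> loewner_le (gramian f B m 0) (mat k2))"

definition controller_assumptions ::
    "(real^'n \<Rightarrow> real^'n) \<Rightarrow> real^'d^'n \<Rightarrow> (real^'n \<Rightarrow> real^'d) \<Rightarrow> real \<Rightarrow> bool" where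
  "controller_assumptions f B k \<mu> \<longleftrightarrow>
     C1_map k \<and>
     (\<exists>L. \<forall>x. norm (jacobian k (at x)) \<le> L) \<and>
     k 0 = 0 \<and>
     (\<exists>\<alpha>>0. AE x in lebesgue.
        (let G = jacobian f (at x) + \<mu> *\<^sub>R (B ** jacobian k (at x))
         in loewner_le (mat \<alpha>) (transpose G ** G)))"

text \<open>
  The pairs \<open>(\<xi>\<^sub>n, \<gamma>\<^sub>n)\<close> are IID. This makes each of the two sequences IID, and it holds in
  particular when the two IID sequences are independent of each other; correlation
  between \<open>\<xi>\<^sub>n\<close> and \<open>\<gamma>\<^sub>n\<close> at the same time \<open>n\<close> is allowed.
\<close>

definition noise_assumptions ::
    "'w measure \<Rightarrow> (nat \<Rightarrow> 'w \<Rightarrow> real) \<Rightarrow> (nat \<Rightarrow> 'w \<Rightarrow> real^'n) \<Rightarrow> real \<Rightarrow> real \<Rightarrow> real \<Rightarrow> bool" where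
  "noise_assumptions M \<xi> \<gamma> \<mu> \<sigma> C \<longleftrightarrow>
     prob_space M \<and>
     prob_space.indep_vars M (\<lambda>_. borel) (\<lambda>n \<omega>. (\<xi> n \<omega>, \<gamma> n \<omega>)) UNIV \<and>
     (\<forall>n. distr M borel (\<lambda>\<omega>. (\<xi> n \<omega>, \<gamma> n \<omega>)) = distr M borel (\<lambda>\<omega>. (\<xi> 0 \<omega>, \<gamma> 0 \<omega>))) \<and>
     (\<forall>n. integrable M (\<xi> n) \<and> (\<integral>\<omega>. \<xi> n \<omega> \<partial>M) = \<mu> \<and>
          integrable M (\<lambda>\<omega>. (\<xi> n \<omega> - \<mu>)\<^sup>2) \<and> (\<integral>\<omega>. (\<xi> n \<omega> - \<mu>)\<^sup>2 \<partial>M) = \<sigma>\<^sup>2) \<and>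
     \<sigma>\<^sup>2 \<noteq> 0 \<and>
     (\<forall>n. integrable M (\<gamma> n) \<and> (\<integral>\<omega>. \<gamma> n \<omega> \<partial>M) = 0 \<and>
          integrable M (\<lambda>\<omega>. (norm (\<gamma> n \<omega>))\<^sup>2) \<and> (\<integral>\<omega>. (norm (\<gamma> n \<omega>))\<^sup>2 \<partial>M) \<le> C)"

primrec trajectory ::
    "(real^'n \<Rightarrow> real^'n) \<Rightarrow> real^'d^'n \<Rightarrow> (real^'n \<Rightarrow> real^'d) \<Rightarrow> (nat \<Rightarrow> real^'d) \<Rightarrow>
     (nat \<Rightarrow> real) \<Rightarrow> (nat \<Rightarrow> real^'n) \<Rightarrow> real^'n \<Rightarrow> nat \<Rightarrow> real^'n" where
  "trajectory f B k w xi g x0 0 = x0"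
| "trajectory f B k w xi g x0 (Suc n) =
     (let x = trajectory f B k w xi g x0 n
      in f x + xi n *\<^sub>R (B *v k x) + xi n *\<^sub>R (B *v w n) + g n)"

text \<open>
  Expectations of squared norms are extended nonnegative integrals, so that an upper bound
  includes finiteness.
\<close>

definition incr_second_moment ::
    "(real^'n \<Rightarrow> real^'n) \<Rightarrow> real^'d^'n \<Rightarrow> (real^'n \<Rightarrow> real^'d) \<Rightarrow> 'w measure \<Rightarrow>
     (nat \<Rightarrow> 'w \<Rightarrow> real) \<Rightarrow> (nat \<Rightarrow> 'w \<Rightarrow> real^'n) \<Rightarrow> (nat \<Rightarrow> real^'d) \<Rightarrow>
     real^'n \<Rightarrow> real^'n \<Rightarrow> nat \<Rightarrow> ennreal" where
  "incr_second_moment f B k M \<xi> \<gamma> w x0 y0 n =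
     (\<integral>\<^sup>+ \<omega>. ennreal ((norm (trajectory f B k w (\<lambda>i. \<xi> i \<omega>) (\<lambda>i. \<gamma> i \<omega>) x0 n
                        - trajectory f B k w (\<lambda>i. \<xi> i \<omega>) (\<lambda>i. \<gamma> i \<omega>) y0 n))\<^sup>2) \<partial>M)"

text \<open>The system without additive noise is the one with the noise sequence \<open>\<lambda>n \<omega>. 0\<close>.\<close>

definition incr_stability_bound ::
    "real \<Rightarrow> real \<Rightarrow> (real^'n \<Rightarrow> real^'n) \<Rightarrow> real^'d^'n \<Rightarrow> (real^'n \<Rightarrow> real^'d) \<Rightarrow> 'w measure \<Rightarrow>
     (nat \<Rightarrow> 'w \<Rightarrow> real) \<Rightarrow> (nat \<Rightarrow> 'w \<Rightarrow> real^'n) \<Rightarrow> real^'n \<Rightarrow> real^'n \<Rightarrow> bool" where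
  "incr_stability_bound K \<beta> f B k M \<xi> \<gamma> x0 y0 \<longleftrightarrow>
     (\<forall>w. \<forall>\<eta> \<in> {\<gamma>, \<lambda>n \<omega>. 0}. \<forall>n.
        incr_second_moment f B k M \<xi> \<eta> w x0 y0 (Suc n) \<le> ennreal (K * \<beta> ^ n * (norm (x0 - y0))\<^sup>2))"

text \<open>
  The constants are exposed so that a second moment bound that is uniform in the additive
  noise can refer to them.
\<close>

definition incr_stability_constants ::
    "real \<Rightarrow> real \<Rightarrow> (real^'n \<Rightarrow> real^'n) \<Rightarrow> real^'d^'n \<Rightarrow> (real^'n \<Rightarrow> real^'d) \<Rightarrow> 'w measure \<Rightarrow>
     (nat \<Rightarrow> 'w \<Rightarrow> real) \<Rightarrow> (nat \<Rightarrow> 'w \<Rightarrow> real^'n) \<Rightarrow> bool" where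
  "incr_stability_constants K \<beta> f B k M \<xi> \<gamma> \<longleftrightarrow>
     0 < K \<and> 0 < \<beta> \<and> \<beta> < 1 \<and>
     (AE x0 in lebesgue. AE y0 in lebesgue. incr_stability_bound K \<beta> f B k M \<xi> \<gamma> x0 y0) \<and>
     (AE y0 in lebesgue. incr_stability_bound K \<beta> f B k M \<xi> \<gamma> 0 y0)"

definition mean_square_exp_incr_stable ::
    "(real^'n \<Rightarrow> real^'n) \<Rightarrow> real^'d^'n \<Rightarrow> (real^'n \<Rightarrow> real^'d) \<Rightarrow> 'w measure \<Rightarrow>
     (nat \<Rightarrow> 'w \<Rightarrow> real) \<Rightarrow> (nat \<Rightarrow> 'w \<Rightarrow> real^'n) \<Rightarrow> bool" where
  "mean_square_exp_incr_stable f B k M \<xi> \<gamma> \<longleftrightarrow>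
     (\<exists>K \<beta>. incr_stability_constants K \<beta> f B k M \<xi> \<gamma>)"

definition second_moment ::
    "(real^'n \<Rightarrow> real^'n) \<Rightarrow> real^'d^'n \<Rightarrow> (real^'n \<Rightarrow> real^'d) \<Rightarrow> 'w measure \<Rightarrow>
     (nat \<Rightarrow> 'w \<Rightarrow> real) \<Rightarrow> (nat \<Rightarrow> 'w \<Rightarrow> real^'n) \<Rightarrow> real^'n \<Rightarrow> nat \<Rightarrow> ennreal" where
  "second_moment f B k M \<xi> \<gamma> x0 n =
     (\<integral>\<^sup>+ \<omega>. ennreal ((norm (trajectory f B k (\<lambda>_. 0) (\<lambda>i. \<xi> i \<omega>) (\<lambda>i. \<gamma> i \<omega>) x0 n))\<^sup>2) \<partial>M)"

end

theory Submission
  imports Defs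
begin

text \<open>
  Write \<open>X\<^sub>n(x)\<close> for the state at time \<open>n\<close> of the system with zero input started from \<open>x\<close>, and
  measure random vectors in \<open>L\<^sup>2\<close>. Incremental stability compares \<open>X\<^sub>n(x)\<close> with \<open>X\<^sub>n(0)\<close>, so it
  suffices to bound \<open>X\<^sub>n(0)\<close>. The origin is an equilibrium of both \<open>f\<close> and \<open>k\<close>, so after one step
  the trajectory from \<open>0\<close> sits at \<open>\<gamma>\<^sub>0\<close>; from there it runs for \<open>n\<close> steps with the noise shifted
  by one, which is independent of \<open>\<gamma>\<^sub>0\<close> and has the law of the unshifted noise. Comparing with
  the trajectory from \<open>0\<close> under that shifted noise, the triangle inequality gives
  \<open>\<parallel>X\<^sub>n\<^sub>+\<^sub>1(0)\<parallel> \<le> \<parallel>X\<^sub>n(0)\<parallel> + (K \<beta>\<^sup>n\<^sup>-\<^sup>1 C)\<^sup>1\<^sup>/\<^sup>2\<close> for \<open>n \<ge> 1\<close>,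
  with \<open>\<parallel>X\<^sub>1(0)\<parallel> \<le> \<surd>C\<close>. The increments form a geometric series, so \<open>X\<^sub>n(0)\<close> is bounded by
  \<open>\<surd>C (1 + \<surd>K / (1 - \<surd>\<beta>))\<close> for all \<open>n \<ge> 1\<close>. The recursion is \<open>second_moment_step\<close> and its
  summation is \<open>second_moment_origin\<close>.

  The law of \<open>\<gamma>\<^sub>0\<close> may charge Lebesgue null sets (it may even be discrete), whereas stability is
  assumed only for almost every starting point. As trajectories depend continuously on the
  starting point, Fatou's lemma along a sequence of good starting points extends the bound to
  every starting point (\<open>incr_bound_everywhere\<close>).
\<close>

section \<open>Square-integrable functions and dense sets of starting points\<close>

text \<open>
  Stated through upper bounds on the two integrals: expanding the square, Cauchy-Schwarz bounds
  the mixed term. Finiteness of the integrals is part of the hypotheses, so all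
  square roots are real numbers.
\<close>

lemma nn_integral_minkowski_2:
  fixes u v :: "'a \<Rightarrow> real"
  assumes [measurable]: "u \<in> borel_measurable M" "v \<in> borel_measurable M"
    and nonneg: "\<And>\<omega>. 0 \<le> u \<omega>" "\<And>\<omega>. 0 \<le> v \<omega>" "0 \<le> a" "0 \<le> b"
    and u: "(\<integral>\<^sup>+\<omega>. ennreal ((u \<omega>)\<^sup>2) \<partial>M) \<le> ennreal (a\<^sup>2)"
    and v: "(\<integral>\<^sup>+\<omega>. ennreal ((v \<omega>)\<^sup>2) \<partial>M) \<le> ennreal (b\<^sup>2)"
  shows "(\<integral>\<^sup>+\<omega>. ennreal ((u \<omega> + v \<omega>)\<^sup>2) \<partial>M) \<le> ennreal ((a + b)\<^sup>2)"
proof -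
  let ?c = "\<integral>\<^sup>+\<omega>. ennreal (u \<omega>) * ennreal (v \<omega>) \<partial>M"
  have "?c\<^sup>2 \<le> (\<integral>\<^sup>+\<omega>. (ennreal (u \<omega>))\<^sup>2 \<partial>M) * (\<integral>\<^sup>+\<omega>. (ennreal (v \<omega>))\<^sup>2 \<partial>M)"
    by (rule Cauchy_Schwarz_nn_integral) auto
  also have "\<dots> \<le> ennreal (a\<^sup>2) * ennreal (b\<^sup>2)"
    using u v nonneg by (intro mult_mono) (auto simp: ennreal_power)
  finally have c2: "?c\<^sup>2 \<le> ennreal ((a * b)\<^sup>2)"
    by (simp add: ennreal_mult' power_mult_distrib)
  have c: "?c \<le> ennreal (a * b)"
  proof (cases ?c)
    case (real r)
    then have "r\<^sup>2 \<le> (a * b)\<^sup>2"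
      using c2 by (simp add: ennreal_power)
    then have "r \<le> a * b"
      by (rule power2_le_imp_le) (simp add: nonneg)
    then show ?thesis
      using real by (simp add: ennreal_leI)
  next
    case top
    then show ?thesis
      using c2 by (simp add: top_unique power2_eq_square ennreal_top_mult)
  qed
  have "(\<integral>\<^sup>+\<omega>. ennreal ((u \<omega> + v \<omega>)\<^sup>2) \<partial>M)
      = (\<integral>\<^sup>+\<omega>. ennreal ((u \<omega>)\<^sup>2) + 2 * (ennreal (u \<omega>) * ennreal (v \<omega>)) + ennreal ((v \<omega>)\<^sup>2) \<partial>M)"
  proof (rule nn_integral_cong)
    fix \<omega>
    have "ennreal ((u \<omega> + v \<omega>)\<^sup>2) = ennreal ((u \<omega>)\<^sup>2 + 2 * (u \<omega> * v \<omega>) + (v \<omega>)\<^sup>2)"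
      by (simp add: power2_sum algebra_simps)
    also have "\<dots> = ennreal ((u \<omega>)\<^sup>2) + 2 * (ennreal (u \<omega>) * ennreal (v \<omega>)) + ennreal ((v \<omega>)\<^sup>2)"
      using nonneg by (simp add: ennreal_plus ennreal_mult' del: power2_sum)
    finally show "ennreal ((u \<omega> + v \<omega>)\<^sup>2) = \<dots>" .
  qed
  also have "\<dots> = (\<integral>\<^sup>+\<omega>. ennreal ((u \<omega>)\<^sup>2) \<partial>M) + 2 * ?c + (\<integral>\<^sup>+\<omega>. ennreal ((v \<omega>)\<^sup>2) \<partial>M)"
    by (simp add: nn_integral_add nn_integral_cmult)
  also have "\<dots> \<le> ennreal (a\<^sup>2) + 2 * ennreal (a * b) + ennreal (b\<^sup>2)"
    by (intro add_mono mult_left_mono u v c) auto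
  also have "2 * ennreal (a * b) = ennreal (2 * (a * b))"
    using nonneg by (simp add: ennreal_mult')
  also have "ennreal (a\<^sup>2) + ennreal (2 * (a * b)) + ennreal (b\<^sup>2) = ennreal (a\<^sup>2 + 2 * (a * b) + b\<^sup>2)"
    using nonneg by (simp flip: ennreal_plus)
  also have "a\<^sup>2 + 2 * (a * b) + b\<^sup>2 = (a + b)\<^sup>2"
    by (simp add: power2_sum)
  finally show ?thesis .
qed

text \<open>A ball has positive measure, so a property that holds almost everywhere holds on a dense set.\<close>

lemma AE_lebesgue_sequence_tendsto:
  fixes y :: "'a::euclidean_space"
  assumes "AE x in lebesgue. P x"
  shows "\<exists>X. (\<forall>i. P (X i)) \<and> X \<longlonglongrightarrow> y"
proof -
  have neg: "negligible {x. \<not> P x}"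
    using assms by (simp add: AE_iff_null_sets negligible_iff_null_sets null_sets_completion_iff
        eventually_ae_filter)
      (metis (no_types, lifting) completion.complete2 mem_Collect_eq space_completion space_lborel UNIV_I subsetI)
  have "y \<in> closure {x. P x}"
    unfolding closure_approachable
  proof (intro allI impI)
    fix e :: real assume "0 < e"
    show "\<exists>x\<in>{x. P x}. dist x y < e"
    proof (rule ccontr)
      assume "\<not> ?thesis"
      then have "ball y e \<subseteq> {x. \<not> P x}"
        by (auto simp: dist_commute)
      then have "negligible (ball y e)"
        using neg negligible_subset by blast
      then show False
        using open_not_negligible[of "ball y e"] \<open>0 < e\<close> by simp
    qed
  qed
  then show ?thesis
    unfolding closure_sequential by simp
qed

section \<open>Trajectories\<close>

lemma C1_map_continuous: "C1_map g \<Longrightarrow> continuous_on UNIV g"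
  by (simp add: C1_map_def differentiable_imp_continuous_on differentiable_on_def
      differentiable_at_withinI)

text \<open>The definition splits off the last step of a trajectory; the recursion needs the first one.\<close>

lemma trajectory_Suc_shift:
  "trajectory f B k w xi g x (Suc n) =
   trajectory f B k (\<lambda>i. w (Suc i)) (\<lambda>i. xi (Suc i)) (\<lambda>i. g (Suc i))
     (trajectory f B k w xi g x (Suc 0)) n"
  by (induction n) (simp_all add: Let_def)

lemma continuous_trajectory:
  assumes "continuous_on UNIV f" "continuous_on UNIV k"
  shows "continuous_on UNIV (\<lambda>x. trajectory f B k w xi g x n)"
proof (induction n)
  case (Suc n)
  have "continuous_on UNIV (\<lambda>x. f (trajectory f B k w xi g x n))"
    "continuous_on UNIV (\<lambda>x. k (trajectory f B k w xi g x n))"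
    using assms Suc by (auto intro: continuous_on_compose2)
  then show ?case
    by (auto simp: Let_def intro!: continuous_intros matrix_vector_mult_linear_continuous_on
        bounded_linear.continuous_on[OF matrix_vector_mul_bounded_linear])
qed simp

text \<open>
  The starting point is allowed to be random because the noise after the first step acts on a
  trajectory that starts from the first noise vector.
\<close>

lemma measurable_trajectory:
  assumes "continuous_on UNIV f" "continuous_on UNIV k"
    and [measurable]: "\<And>i. xi i \<in> borel_measurable M" "\<And>i. g i \<in> borel_measurable M"
      "X \<in> borel_measurable M"
  shows "(\<lambda>\<omega>. trajectory f B k w (\<lambda>i. xi i \<omega>) (\<lambda>i. g i \<omega>) (X \<omega>) n) \<in> borel_measurable M"
proof (induction n)
  case (Suc n)
  have [measurable]: "f \<in> borel_measurable borel" "k \<in> borel_measurable borel"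
    "(*v) B \<in> borel_measurable borel"
    using assms by (auto intro!: borel_measurable_continuous_onI linear_continuous_on)
  note Suc.IH[measurable]
  show ?case
    by (simp add: Let_def)
qed simp

lemma measurable_trajectory_pairs:
  fixes f :: "real^'n \<Rightarrow> real^'n" and S :: "'a \<Rightarrow> nat \<Rightarrow> real \<times> (real^'n)"
  assumes cont: "continuous_on UNIV f" "continuous_on UNIV k"
    and S: "\<And>i. (\<lambda>\<omega>. S \<omega> i) \<in> borel_measurable M" and X: "X \<in> borel_measurable M"
  shows "(\<lambda>\<omega>. trajectory f B k w (\<lambda>i. fst (S \<omega> i)) (\<lambda>i. snd (S \<omega> i)) (X \<omega>) n) \<in> borel_measurable M"
proof (rule measurable_trajectory[OF cont _ _ X])
  show "(\<lambda>\<omega>. fst (S \<omega> i)) \<in> borel_measurable M" "(\<lambda>\<omega>. snd (S \<omega> i)) \<in> borel_measurable M" for i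
    by (intro borel_measurable_continuous_on[OF _ S] continuous_intros)+
qed

section \<open>The law of the noise sequence\<close>

text \<open>
  Passing to the law of the noise on sequence space makes the time shift available: an
  infinite power of \<open>P\<close> is the product of \<open>P\<close> with that same power, whereas the underlying probability
  space carries no shift.
\<close>

lemma noise_law:
  assumes "noise_assumptions M \<xi> \<gamma> \<mu> \<sigma> C"
  defines "P \<equiv> distr M borel (\<lambda>\<omega>. (\<xi> 0 \<omega>, \<gamma> 0 \<omega>))"
  shows "distr M (\<Pi>\<^sub>M i\<in>UNIV. borel) (\<lambda>\<omega> i. (\<xi> i \<omega>, \<gamma> i \<omega>)) = (\<Pi>\<^sub>M i\<in>(UNIV::nat set). P)"
proof -
  interpret prob_space M
    using assms by (simp add: noise_assumptions_def)
  have ind: "indep_vars (\<lambda>_. borel) (\<lambda>n \<omega>. (\<xi> n \<omega>, \<gamma> n \<omega>)) UNIV"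
    and law: "\<And>n. distr M borel (\<lambda>\<omega>. (\<xi> n \<omega>, \<gamma> n \<omega>)) = P"
    using assms by (simp_all add: noise_assumptions_def)
  have "distr M (\<Pi>\<^sub>M i\<in>UNIV. borel) (\<lambda>\<omega>. \<lambda>i\<in>UNIV. (\<xi> i \<omega>, \<gamma> i \<omega>)) =
      (\<Pi>\<^sub>M i\<in>UNIV. distr M borel (\<lambda>\<omega>. (\<xi> i \<omega>, \<gamma> i \<omega>)))"
    using ind by (subst indep_vars_iff_distr_eq_PiM[symmetric]) (auto simp: indep_vars_def)
  then show ?thesis
    by (simp add: law restrict_UNIV)
qed

lemma noise_measurable:
  assumes "noise_assumptions M \<xi> \<gamma> \<mu> \<sigma> C"
  shows "\<xi> i \<in> borel_measurable M" "\<gamma> i \<in> borel_measurable M"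
  using assms by (auto simp: noise_assumptions_def intro: borel_measurable_integrable)

lemma noise_bound_nonneg:
  assumes "noise_assumptions M \<xi> \<gamma> \<mu> \<sigma> C"
  shows "0 \<le> C"
proof -
  have "0 \<le> (\<integral>\<omega>. (norm (\<gamma> 0 \<omega>))\<^sup>2 \<partial>M)"
    by simp
  also have "\<dots> \<le> C"
    using assms by (simp add: noise_assumptions_def)
  finally show ?thesis .
qed

lemma nn_integral_split_first:
  fixes P :: "'a measure"
  assumes "prob_space P" and F: "F \<in> borel_measurable (\<Pi>\<^sub>M i\<in>(UNIV::nat set). P)"
  shows "(\<integral>\<^sup>+s. F s \<partial>(\<Pi>\<^sub>M i\<in>UNIV. P)) =
    (\<integral>\<^sup>+z. F (case_nat (fst z) (snd z)) \<partial>(P \<Otimes>\<^sub>M (\<Pi>\<^sub>M i\<in>(UNIV::nat set). P)))"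
proof -
  interpret P: prob_space P by fact
  interpret S: sequence_space P ..
  show ?thesis
    using F by (subst S.PiM_iter[symmetric], subst nn_integral_distr)
      (simp_all add: split_beta')
qed

section \<open>Second moments from the origin\<close>

text \<open>Trajectories are continuous in the starting point, so Fatou's lemma applies to a sequence
  of starting points that satisfy the bound and converge to \<open>y\<close>.\<close>

lemma incr_bound_everywhere:
  assumes cont: "continuous_on UNIV f" "continuous_on UNIV k"
    and meas: "\<And>i. xi i \<in> borel_measurable M" "\<And>i. g i \<in> borel_measurable M"
    and ae: "AE y in lebesgue. incr_second_moment f B k M xi g w x y n
        \<le> ennreal (c * (norm (x - y))\<^sup>2)"
  shows "incr_second_moment f B k M xi g w x y n \<le> ennreal (c * (norm (x - y))\<^sup>2)"
proof -
  obtain Y where Y: "\<And>i. incr_second_moment f B k M xi g w x (Y i) n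
      \<le> ennreal (c * (norm (x - Y i))\<^sup>2)" and lim: "Y \<longlonglongrightarrow> y"
    using AE_lebesgue_sequence_tendsto[OF ae] by blast
  let ?T = "\<lambda>z \<omega>. trajectory f B k w (\<lambda>i. xi i \<omega>) (\<lambda>i. g i \<omega>) z n"
  let ?h = "\<lambda>z \<omega>. ennreal ((norm (?T x \<omega> - ?T z \<omega>))\<^sup>2)"
  have [measurable]: "?T z \<in> borel_measurable M" for z
    using cont meas by (intro measurable_trajectory) auto
  have "(\<lambda>i. ?T (Y i) \<omega>) \<longlonglongrightarrow> ?T y \<omega>" for \<omega>
    using continuous_on_tendsto_compose[OF continuous_trajectory[OF cont] lim] by simp
  then have "(\<lambda>i. ?h (Y i) \<omega>) \<longlonglongrightarrow> ?h y \<omega>" for \<omega>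
    by (intro tendsto_ennrealI tendsto_intros)
  then have "liminf (\<lambda>i. ?h (Y i) \<omega>) = ?h y \<omega>" for \<omega>
    by (intro lim_imp_Liminf) auto
  then have "incr_second_moment f B k M xi g w x y n = (\<integral>\<^sup>+\<omega>. liminf (\<lambda>i. ?h (Y i) \<omega>) \<partial>M)"
    by (simp add: incr_second_moment_def)
  also have "\<dots> \<le> liminf (\<lambda>i. \<integral>\<^sup>+\<omega>. ?h (Y i) \<omega> \<partial>M)"
    by (rule nn_integral_liminf) measurable
  also have "\<dots> \<le> liminf (\<lambda>i. ennreal (c * (norm (x - Y i))\<^sup>2))"
    using Y by (intro Liminf_mono always_eventually) (auto simp: incr_second_moment_def)
  also have "\<dots> = ennreal (c * (norm (x - y))\<^sup>2)"
    by (intro lim_imp_Liminf tendsto_ennrealI tendsto_intros lim) auto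
  finally show ?thesis .
qed

text \<open>
  One step of the recursion. Here \<open>P\<close> is the law of a single noise pair, \<open>T n x s\<close> is the state at
  time \<open>n\<close> under the noise sequence \<open>s\<close>, and \<open>L\<close> is the \<open>L\<^sup>2\<close> Lipschitz constant of \<open>T n\<close> at the
  origin. Under \<open>P \<Otimes>\<^sub>M J\<close> the first noise pair is independent of the later noise, so the
  incremental bound may be integrated over the random starting point \<open>snd p\<close>.
\<close>

lemma second_moment_step:
  fixes f :: "real^'n \<Rightarrow> real^'n" and B :: "real^'d^'n" and k :: "real^'n \<Rightarrow> real^'d"
    and P :: "(real \<times> (real^'n)) measure"
  assumes J_def: "J = (\<Pi>\<^sub>M i\<in>(UNIV::nat set). P)"
    and T_def: "T = (\<lambda>n x s. trajectory f B k (\<lambda>_. 0) (\<lambda>i. fst (s i)) (\<lambda>i. snd (s i)) x n)"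
    and cont: "continuous_on UNIV f" "continuous_on UNIV k" and zero: "f 0 = 0" "k 0 = 0"
    and P: "prob_space P" and sets_P: "sets P = sets borel"
    and nonneg: "0 \<le> L" "0 \<le> c" "0 \<le> r"
    and noise: "(\<integral>\<^sup>+p. ennreal ((norm (snd p))\<^sup>2) \<partial>P) \<le> ennreal (c\<^sup>2)"
    and incr: "\<And>y. (\<integral>\<^sup>+s. ennreal ((norm (T n 0 s - T n y s))\<^sup>2) \<partial>J) \<le> ennreal (L\<^sup>2 * (norm y)\<^sup>2)"
    and origin: "(\<integral>\<^sup>+s. ennreal ((norm (T n 0 s))\<^sup>2) \<partial>J) \<le> ennreal (r\<^sup>2)"
  shows "(\<integral>\<^sup>+s. ennreal ((norm (T (Suc n) 0 s))\<^sup>2) \<partial>J) \<le> ennreal ((L * c + r)\<^sup>2)"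
proof -
  interpret P: prob_space P by fact
  interpret J: prob_space J
    unfolding J_def by (intro prob_space_PiM P)
  note [measurable_cong] = sets_P
  have coord[measurable]: "(\<lambda>s. s i) \<in> measurable J borel" for i
    using measurable_component_singleton[of i UNIV "\<lambda>_. P"] sets_P
    unfolding J_def by (simp cong: measurable_cong_sets)
  have [measurable]: "T m x \<in> borel_measurable J" for m x
    unfolding T_def by (intro measurable_trajectory_pairs cont coord measurable_const) simp
  have snd_P: "snd \<in> borel_measurable P"
    using borel_measurable_continuous_onI[OF continuous_on_snd[OF continuous_on_id]] sets_P
    by (simp add: id_def cong: measurable_cong_sets)
  have "(\<lambda>z. snd (fst z)) \<in> borel_measurable (P \<Otimes>\<^sub>M J)"
    by (rule measurable_compose[OF measurable_fst snd_P])
  then have [measurable]: "(\<lambda>z. T n (snd (fst z)) (snd z)) \<in> borel_measurable (P \<Otimes>\<^sub>M J)"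
    unfolding T_def
    by (intro measurable_trajectory_pairs cont measurable_compose[OF measurable_snd coord])
  note snd_P[measurable]
  let ?u = "\<lambda>z. norm (T n 0 (snd z) - T n (snd (fst z)) (snd z))"
  let ?v = "\<lambda>z. norm (T n 0 (snd z))"
  \<comment> \<open>the first step from the origin leads to the first noise vector, as \<open>f\<close> and \<open>k\<close> vanish there\<close>
  have shift: "T (Suc n) 0 (case_nat p s) = T n (snd p) s" for p s
    unfolding T_def trajectory_Suc_shift[of _ _ _ _ _ _ _ n] by (simp add: zero)
  have u: "(\<integral>\<^sup>+z. ennreal ((?u z)\<^sup>2) \<partial>(P \<Otimes>\<^sub>M J)) \<le> ennreal ((L * c)\<^sup>2)"
  proof -
    have "(\<integral>\<^sup>+z. ennreal ((?u z)\<^sup>2) \<partial>(P \<Otimes>\<^sub>M J))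
        = (\<integral>\<^sup>+p. (\<integral>\<^sup>+s. ennreal ((?u (p, s))\<^sup>2) \<partial>J) \<partial>P)"
      by (rule J.nn_integral_fst[symmetric]) measurable
    also have "\<dots> \<le> (\<integral>\<^sup>+p. ennreal (L\<^sup>2) * ennreal ((norm (snd p))\<^sup>2) \<partial>P)"
      using incr by (intro nn_integral_mono) (simp add: ennreal_mult')
    also have "\<dots> = ennreal (L\<^sup>2) * (\<integral>\<^sup>+p. ennreal ((norm (snd p))\<^sup>2) \<partial>P)"
      by (intro nn_integral_cmult) measurable
    also have "\<dots> \<le> ennreal (L\<^sup>2) * ennreal (c\<^sup>2)"
      by (intro mult_left_mono noise) auto
    finally show ?thesis
      by (simp add: ennreal_mult' power_mult_distrib)
  qed
  have v: "(\<integral>\<^sup>+z. ennreal ((?v z)\<^sup>2) \<partial>(P \<Otimes>\<^sub>M J)) \<le> ennreal (r\<^sup>2)"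
  proof -
    have "(\<integral>\<^sup>+z. ennreal ((?v z)\<^sup>2) \<partial>(P \<Otimes>\<^sub>M J))
        = (\<integral>\<^sup>+p. (\<integral>\<^sup>+s. ennreal ((?v (p, s))\<^sup>2) \<partial>J) \<partial>P)"
      by (rule J.nn_integral_fst[symmetric]) measurable
    then show ?thesis
      using origin by (simp add: P.emeasure_space_1)
  qed
  have "(\<integral>\<^sup>+s. ennreal ((norm (T (Suc n) 0 s))\<^sup>2) \<partial>J)
      = (\<integral>\<^sup>+z. ennreal ((norm (T n (snd (fst z)) (snd z)))\<^sup>2) \<partial>(P \<Otimes>\<^sub>M J))"
    unfolding J_def by (subst nn_integral_split_first[OF P]) (simp_all add: shift flip: J_def)
  also have "\<dots> \<le> (\<integral>\<^sup>+z. ennreal ((?u z + ?v z)\<^sup>2) \<partial>(P \<Otimes>\<^sub>M J))"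
    by (intro nn_integral_mono ennreal_leI power_mono)
      (auto intro: norm_triangle_sub[THEN order_trans] simp: norm_minus_commute add.commute)
  also have "\<dots> \<le> ennreal ((L * c + r)\<^sup>2)"
    using nonneg u v by (intro nn_integral_minkowski_2) auto
  finally show ?thesis .
qed

text \<open>
  The stability estimate at time \<open>n + 1\<close> has the factor \<open>K \<beta>\<^sup>n\<close>, so the \<open>L\<^sup>2\<close> increments are
  \<open>\<surd>C \<surd>K (\<surd>\<beta>)\<^sup>n\<close> and sum to a bound that is uniform in \<open>n\<close>.
\<close>

lemma second_moment_origin:
  fixes f :: "real^'n \<Rightarrow> real^'n" and B :: "real^'d^'n" and k :: "real^'n \<Rightarrow> real^'d"
  assumes cont: "continuous_on UNIV f" "continuous_on UNIV k" and zero: "f 0 = 0" "k 0 = 0"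
    and noise: "noise_assumptions M \<xi> \<gamma> \<mu> \<sigma> C"
    and K: "0 \<le> K" and \<beta>: "0 \<le> \<beta>" "\<beta> < 1"
    and incr: "\<And>y n. incr_second_moment f B k M \<xi> \<gamma> (\<lambda>_. 0) 0 y (Suc n)
        \<le> ennreal (K * \<beta> ^ n * (norm y)\<^sup>2)"
  shows "second_moment f B k M \<xi> \<gamma> 0 (Suc n)
    \<le> ennreal ((sqrt C * (1 + sqrt K / (1 - sqrt \<beta>)))\<^sup>2)"
proof -
  define P where "P = distr M borel (\<lambda>\<omega>. (\<xi> 0 \<omega>, \<gamma> 0 \<omega>))"
  define J where "J = (\<Pi>\<^sub>M i\<in>(UNIV::nat set). P)"
  define T where "T = (\<lambda>n x s.
    trajectory f B k (\<lambda>_. 0) (\<lambda>i. fst (s i :: real \<times> (real^'n))) (\<lambda>i. snd (s i)) x n)"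
  interpret prob_space M
    using noise by (simp add: noise_assumptions_def)
  note [measurable] = noise_measurable[OF noise]
  have P: "prob_space P" "sets P = sets borel"
    unfolding P_def by (auto intro: prob_space_distr)
  have moment: "integrable M (\<lambda>\<omega>. (norm (\<gamma> 0 \<omega>))\<^sup>2)" "(\<integral>\<omega>. (norm (\<gamma> 0 \<omega>))\<^sup>2 \<partial>M) \<le> C"
    using noise by (simp_all add: noise_assumptions_def)
  note C = noise_bound_nonneg[OF noise]
  have noise_P: "(\<integral>\<^sup>+p. ennreal ((norm (snd p))\<^sup>2) \<partial>P) \<le> ennreal ((sqrt C)\<^sup>2)"
  proof -
    have [measurable]: "(\<lambda>p. snd p) \<in> borel_measurable (borel :: (real \<times> (real^'n)) measure)"
      by (intro borel_measurable_continuous_onI continuous_intros)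
    have "(\<integral>\<^sup>+p. ennreal ((norm (snd p))\<^sup>2) \<partial>P) = (\<integral>\<^sup>+\<omega>. ennreal ((norm (\<gamma> 0 \<omega>))\<^sup>2) \<partial>M)"
      unfolding P_def by (subst nn_integral_distr) simp_all
    also have "\<dots> \<le> ennreal C"
      using moment by (simp add: nn_integral_eq_integral ennreal_leI)
    finally show ?thesis
      using C by simp
  qed
  have T_meas[measurable]: "T n x \<in> borel_measurable (\<Pi>\<^sub>M i\<in>UNIV. borel)" for n x
    unfolding T_def
    by (intro measurable_trajectory_pairs cont measurable_component_singleton measurable_const) simp_all
  have J: "J = distr M (\<Pi>\<^sub>M i\<in>UNIV. borel) (\<lambda>\<omega> i. (\<xi> i \<omega>, \<gamma> i \<omega>))"
    unfolding J_def P_def using noise_law[OF noise] by simp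
  have transfer: "(\<integral>\<^sup>+s. F s \<partial>J) = (\<integral>\<^sup>+\<omega>. F (\<lambda>i. (\<xi> i \<omega>, \<gamma> i \<omega>)) \<partial>M)"
    if "F \<in> borel_measurable (\<Pi>\<^sub>M i\<in>UNIV. borel)" for F
    unfolding J using that by (intro nn_integral_distr) (auto intro!: measurable_PiM_single')
  have second: "second_moment f B k M \<xi> \<gamma> 0 n = (\<integral>\<^sup>+s. ennreal ((norm (T n 0 s))\<^sup>2) \<partial>J)" for n
    by (subst transfer) (measurable, simp add: second_moment_def T_def)
  have incr_J: "(\<integral>\<^sup>+s. ennreal ((norm (T (Suc n) 0 s - T (Suc n) y s))\<^sup>2) \<partial>J)
      \<le> ennreal ((sqrt K * sqrt \<beta> ^ n)\<^sup>2 * (norm y)\<^sup>2)" for n y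
  proof -
    have "(\<integral>\<^sup>+s. ennreal ((norm (T (Suc n) 0 s - T (Suc n) y s))\<^sup>2) \<partial>J)
        = incr_second_moment f B k M \<xi> \<gamma> (\<lambda>_. 0) 0 y (Suc n)"
      by (subst transfer) (measurable, simp add: incr_second_moment_def T_def)
    also have "\<dots> \<le> ennreal (K * \<beta> ^ n * (norm y)\<^sup>2)"
      by (rule incr)
    also have "K * \<beta> ^ n = (sqrt K * sqrt \<beta> ^ n)\<^sup>2"
      using K \<beta> by (simp add: power_mult_distrib flip: real_sqrt_power)
    finally show ?thesis .
  qed
  note step = second_moment_step[OF J_def T_def cont zero P]
  have sum: "second_moment f B k M \<xi> \<gamma> 0 (Suc n)
      \<le> ennreal ((sqrt C * (1 + sqrt K * (\<Sum>i<n. sqrt \<beta> ^ i)))\<^sup>2)" for n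
  proof (induction n)
    case 0
    \<comment> \<open>at time 0 the Lipschitz constant is 1; the factor \<open>K\<close> enters only from time 1 on\<close>
    have "(\<integral>\<^sup>+s. ennreal ((norm (T (Suc 0) 0 s))\<^sup>2) \<partial>J) \<le> ennreal ((1 * sqrt C + 0)\<^sup>2)"
    proof (rule step)
      interpret J: prob_space J
        unfolding J_def by (intro prob_space_PiM P)
      show "(\<integral>\<^sup>+s. ennreal ((norm (T 0 0 s - T 0 y s))\<^sup>2) \<partial>J) \<le> ennreal (1\<^sup>2 * (norm y)\<^sup>2)" for y
        by (simp add: T_def J.emeasure_space_1)
      show "(\<integral>\<^sup>+s. ennreal ((norm (T 0 0 s))\<^sup>2) \<partial>J) \<le> ennreal (0\<^sup>2)"
        by (simp add: T_def)
    qed (use C noise_P in auto)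
    then show ?case
      by (simp add: second)
  next
    case (Suc n)
    have "second_moment f B k M \<xi> \<gamma> 0 (Suc (Suc n)) \<le>
        ennreal ((sqrt K * sqrt \<beta> ^ n * sqrt C + sqrt C * (1 + sqrt K * (\<Sum>i<n. sqrt \<beta> ^ i)))\<^sup>2)"
      unfolding second
    proof (rule step)
      show "(\<integral>\<^sup>+s. ennreal ((norm (T (Suc n) 0 s))\<^sup>2) \<partial>J)
          \<le> ennreal ((sqrt C * (1 + sqrt K * (\<Sum>i<n. sqrt \<beta> ^ i)))\<^sup>2)"
        using Suc by (simp only: second)
    qed (use C K \<beta> noise_P incr_J in \<open>auto intro!: mult_nonneg_nonneg add_nonneg_nonneg sum_nonneg\<close>)
    then show ?case
      by (simp add: algebra_simps)
  qed
  have s: "0 \<le> sqrt \<beta>" "sqrt \<beta> < 1"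
    using \<beta> by auto
  have "(\<Sum>i<n. sqrt \<beta> ^ i) \<le> (\<Sum>i. sqrt \<beta> ^ i)"
    using s by (intro sum_le_suminf summable_geometric) auto
  also have "\<dots> = 1 / (1 - sqrt \<beta>)"
    using s by (intro suminf_geometric) auto
  finally have "sqrt K * (\<Sum>i<n. sqrt \<beta> ^ i) \<le> sqrt K * (1 / (1 - sqrt \<beta>))"
    using K by (intro mult_left_mono) auto
  then have "sqrt C * (1 + sqrt K * (\<Sum>i<n. sqrt \<beta> ^ i)) \<le> sqrt C * (1 + sqrt K / (1 - sqrt \<beta>))"
    using C by (intro mult_left_mono) auto
  then show ?thesis
    using C K s
    by (intro order_trans[OF sum] ennreal_leI power_mono)
      (auto intro!: mult_nonneg_nonneg add_nonneg_nonneg sum_nonneg)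
qed

theorem theorem2p8:
  fixes f :: "real^'n \<Rightarrow> real^'n"
    and B :: "real^'d^'n"
    and k :: "real^'n \<Rightarrow> real^'d"
  assumes "plant_assumptions f B"
    and "gramian_bounds f B"
  shows "\<exists>bound :: real \<Rightarrow> real \<Rightarrow> real measure \<Rightarrow> real \<Rightarrow> real^'n \<Rightarrow> real.
    \<forall>(M :: 'w measure) \<xi> \<gamma> \<mu> \<sigma> C.
      noise_assumptions M \<xi> \<gamma> \<mu> \<sigma> C \<longrightarrow>
      controller_assumptions f B k \<mu> \<longrightarrow>
      mean_square_exp_incr_stable f B k M \<xi> \<gamma> \<longrightarrow>
      (\<forall>K \<beta>. incr_stability_constants K \<beta> f B k M \<xi> \<gamma> \<longrightarrow>
        (\<forall>x0 n. second_moment f B k M \<xi> \<gamma> x0 (Suc n)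
                  \<le> ennreal (bound K \<beta> (distr M borel (\<xi> 0)) C x0)))"
proof -
  define bound :: "real \<Rightarrow> real \<Rightarrow> real measure \<Rightarrow> real \<Rightarrow> real^'n \<Rightarrow> real"
    where "bound K \<beta> D C x =
      (sqrt K * norm x + sqrt C * (1 + sqrt K / (1 - sqrt \<beta>)))\<^sup>2" for K \<beta> D C x
  have "second_moment f B k M \<xi> \<gamma> x (Suc n) \<le> ennreal (bound K \<beta> (distr M borel (\<xi> 0)) C x)"
    if noise: "noise_assumptions M \<xi> \<gamma> \<mu> \<sigma> C" and ctrl: "controller_assumptions f B k \<mu>"
      and stable: "incr_stability_constants K \<beta> f B k M \<xi> \<gamma>"
    for M :: "'w measure" and \<xi> \<gamma> \<mu> \<sigma> C K \<beta> x n
  proof -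
    have cont: "continuous_on UNIV f" "continuous_on UNIV k" and zero: "f 0 = 0" "k 0 = 0"
      using assms(1) ctrl
      by (auto simp: plant_assumptions_def controller_assumptions_def C1_map_continuous)
    note [measurable] = noise_measurable[OF noise]
    have const: "0 < K" "0 < \<beta>" "\<beta> < 1"
      and ae: "AE y in lebesgue. incr_stability_bound K \<beta> f B k M \<xi> \<gamma> 0 y"
      using stable by (simp_all add: incr_stability_constants_def)
    have incr: "incr_second_moment f B k M \<xi> \<gamma> (\<lambda>_. 0) 0 y (Suc n)
        \<le> ennreal (K * \<beta> ^ n * (norm y)\<^sup>2)" for y n
    proof -
      have "AE y in lebesgue. incr_second_moment f B k M \<xi> \<gamma> (\<lambda>_. 0) 0 y (Suc n)
          \<le> ennreal (K * \<beta> ^ n * (norm (0 - y))\<^sup>2)"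
        using ae by eventually_elim (auto simp: incr_stability_bound_def)
      from incr_bound_everywhere[OF cont _ _ this, of y] show ?thesis
        by simp
    qed
    let ?T = "\<lambda>x \<omega>. trajectory f B k (\<lambda>_. 0) (\<lambda>i. \<xi> i \<omega>) (\<lambda>i. \<gamma> i \<omega>) x (Suc n)"
    let ?r = "sqrt C * (1 + sqrt K / (1 - sqrt \<beta>))"
    have [measurable]: "?T x \<in> borel_measurable M" for x
      using cont by (intro measurable_trajectory) auto
    note C = noise_bound_nonneg[OF noise]
    have "K * \<beta> ^ n * (norm x)\<^sup>2 \<le> K * 1 * (norm x)\<^sup>2"
      using const by (intro mult_right_mono mult_left_mono power_le_one) auto
    then have "K * \<beta> ^ n * (norm x)\<^sup>2 \<le> (sqrt K * norm x)\<^sup>2"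
      using const by (simp add: power_mult_distrib)
    then have u: "(\<integral>\<^sup>+\<omega>. ennreal ((norm (?T 0 \<omega> - ?T x \<omega>))\<^sup>2) \<partial>M) \<le> ennreal ((sqrt K * norm x)\<^sup>2)"
      using order_trans[OF incr ennreal_leI] by (simp only: incr_second_moment_def)
    have v: "(\<integral>\<^sup>+\<omega>. ennreal ((norm (?T 0 \<omega>))\<^sup>2) \<partial>M) \<le> ennreal (?r\<^sup>2)"
      using second_moment_origin[OF cont zero noise _ _ _ incr] const
      by (simp add: second_moment_def del: trajectory.simps)
    have "second_moment f B k M \<xi> \<gamma> x (Suc n)
        \<le> (\<integral>\<^sup>+\<omega>. ennreal ((norm (?T 0 \<omega> - ?T x \<omega>) + norm (?T 0 \<omega>))\<^sup>2) \<partial>M)"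
      unfolding second_moment_def
      by (intro nn_integral_mono ennreal_leI power_mono norm_ge_zero)
        (metis norm_minus_commute norm_triangle_sub add.commute)
    also have "\<dots> \<le> ennreal ((sqrt K * norm x + ?r)\<^sup>2)"
      using const C by (intro nn_integral_minkowski_2 u v) (simp_all del: trajectory.simps)
    finally show ?thesis
      by (simp add: bound_def)
  qed
  then show ?thesis
    by blast
qed

end
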